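(* Let $r\geq 1$, $n\geq 0$ and $m=n+r$. The set $\mathrm{UPF}_m^r$ of unit interval parking functions of length $m$ whose first $r$ entries are distinct is in bijection with the set $\mathrm{FR}_m^r$ of $r$-Fubini rankings of length $m$.
   Context: Let $[m]=\{1,\dots,m\}$. Unit interval parking: $m$ cars enter in order $1,\dots,m$ a one-way street with spots $1,\dots,m$; with preference list $\alpha=(a_1,\dots,a_m)\in[m]^m$, car $i$ parks in spot $a_i$ if free, otherwise in spot $a_i+1$ if it exists and is free, otherwise it fails. $\alpha$ is a unit interval parking function if all cars park. $\mathrm{UPF}_m^r$ is the set of unit interval parking functions $\alpha$ of length $m$ with $|\{a_1,\dots,a_r\}|=r$. A tuple $\beta\in[m]^m$ is a Fubini ranking if its smallest value is $1$ and for every $x$, if exactly $k>0$ entries equal $x$, the next largest value occurring in $\beta$ (if any) is $x+k$. An $r$-Fubini ranking of length $m=n+r$ is a Fubini ranking $(b_1,\dots,b_m)$ with $|\{b_1,\dots,b_r\}|=r$; $\mathrm{FR}_m^r$ is the set of these. *)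

theory Defs
  imports Main
begin

definition tuples :: "nat \<Rightarrow> nat list set" where
  "tuples m = {\<alpha>. length \<alpha> = m \<and> set \<alpha> \<subseteq> {1..m}}"

(* occ is the set of occupied spots; None means that the car fails to park. *)
definition unit_spot :: "nat \<Rightarrow> nat set \<Rightarrow> nat \<Rightarrow> nat option" where
  "unit_spot m occ a =
     (if a \<notin> occ then Some a
      else if a + 1 \<le> m \<and> a + 1 \<notin> occ then Some (a + 1)
      else None)"

primrec all_park :: "nat \<Rightarrow> nat set \<Rightarrow> nat list \<Rightarrow> bool" where
  "all_park m occ [] = True"
| "all_park m occ (a # as) =
     (case unit_spot m occ a of
        None \<Rightarrow> False
      | Some s \<Rightarrow> all_park m (insert s occ) as)"

definition unit_interval_pf :: "nat \<Rightarrow> nat list \<Rightarrow> bool" where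
  "unit_interval_pf m \<alpha> \<longleftrightarrow> \<alpha> \<in> tuples m \<and> all_park m {} \<alpha>"

definition UPF :: "nat \<Rightarrow> nat \<Rightarrow> nat list set" where
  "UPF m r = {\<alpha>. unit_interval_pf m \<alpha> \<and> card (set (take r \<alpha>)) = r}"

definition next_value :: "nat list \<Rightarrow> nat \<Rightarrow> nat \<Rightarrow> bool" where
  "next_value \<beta> x y \<longleftrightarrow> y \<in> set \<beta> \<and> x < y \<and> (\<forall>z\<in>set \<beta>. x < z \<longrightarrow> y \<le> z)"

(* Meaningful for m \<ge> 1 only: Min of the empty set is unspecified. *)
definition fubini_ranking :: "nat \<Rightarrow> nat list \<Rightarrow> bool" where
  "fubini_ranking m \<beta> \<longleftrightarrow>
     \<beta> \<in> tuples m \<and> Min (set \<beta>) = 1 \<and>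
     (\<forall>x y. count_list \<beta> x > 0 \<longrightarrow> next_value \<beta> x y \<longrightarrow> y = x + count_list \<beta> x)"

definition FR :: "nat \<Rightarrow> nat \<Rightarrow> nat list set" where
  "FR m r = {\<beta>. fubini_ranking m \<beta> \<and> card (set (take r \<beta>)) = r}"

end

theory Submission
  imports Defs
begin

text \<open>
  Cut the occupied spots of a unit interval parking function into blocks: a car that finds its
  preferred spot free starts a new block there, and a car bumped from spot \<open>a\<close> to \<open>a + 1\<close> joins the
  block of \<open>a\<close>. The cars of the block starting at \<open>b\<close> then have, in order of arrival, the
  preferences \<open>b, b, b + 1, b + 2, \<dots>\<close>. Replacing every preference by the start of its block gives
  a Fubini ranking, because the blocks tile \<open>{1..m}\<close>; the preferences are recovered by counting
  the previous occurrences of each rank. The first two cars of a block share their preference, so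
  both maps are the identity on prefixes without repetitions.
\<close>

section \<open>The two maps and their common invariant\<close>

text \<open>The map \<open>M\<close> sends every occupied spot to the start of its block.\<close>

primrec block_starts :: "(nat \<Rightarrow> nat option) \<Rightarrow> nat list \<Rightarrow> nat list" where
  "block_starts M [] = []"
| "block_starts M (a # as) =
     (case M a of
        None \<Rightarrow> a # block_starts (M(a \<mapsto> a)) as
      | Some b \<Rightarrow> b # block_starts (M(a + 1 \<mapsto> b)) as)"

text \<open>The number \<open>C b\<close> counts the earlier occurrences of \<open>b\<close>. The truncated subtraction is
  intended: the occurrences of \<open>b\<close> become \<open>b, b, b + 1, b + 2, \<dots>\<close>.\<close>

primrec preferences :: "(nat \<Rightarrow> nat) \<Rightarrow> nat list \<Rightarrow> nat list" where
  "preferences C [] = []"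
| "preferences C (b # bs) = (b + (C b - 1)) # preferences (C(b := C b + 1)) bs"

text \<open>Invariant linking the states of the two recursions. Since \<open>M\<close> is
  single-valued, it makes the intervals \<open>{b..<b + C b}\<close> pairwise disjoint.\<close>

definition tiled :: "(nat \<Rightarrow> nat option) \<Rightarrow> (nat \<Rightarrow> nat) \<Rightarrow> bool" where
  "tiled M C \<longleftrightarrow> (\<forall>s b. M s = Some b \<longleftrightarrow> b \<le> s \<and> s < b + C b)"

lemma tiledD: "tiled M C \<Longrightarrow> M s = Some b \<longleftrightarrow> b \<le> s \<and> s < b + C b"
  by (simp add: tiled_def)

lemma tiled_empty: "tiled Map.empty (\<lambda>_. 0)"
  by (simp add: tiled_def)

lemma tiled_update:
  assumes "tiled M C" "M (b + C b) = None"
  shows "tiled (M(b + C b \<mapsto> b)) (C(b := C b + 1))"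
  unfolding tiled_def
proof (intro allI)
  fix s x
  have "\<not> (x \<le> b + C b \<and> b + C b < x + C x)"
    using tiledD[OF assms(1), of "b + C b" x] assms(2) by simp
  then show "(M(b + C b \<mapsto> b)) s = Some x \<longleftrightarrow> x \<le> s \<and> s < x + (C(b := C b + 1)) x"
    using tiledD[OF assms(1), of s x] by (cases "s = b + C b"; cases "x = b") auto
qed

lemma count_list_pos_iff: "0 < count_list xs x \<longleftrightarrow> x \<in> set xs"
  by (induction xs) auto

section \<open>Lengths and prefixes\<close>

lemma length_block_starts [simp]: "length (block_starts M as) = length as"
  by (induction as arbitrary: M) (auto split: option.splits)

lemma length_preferences [simp]: "length (preferences C bs) = length bs"
  by (induction bs arbitrary: C) auto

lemma take_block_starts: "take r (block_starts M as) = block_starts M (take r as)"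
  by (induction as arbitrary: M r) (auto simp: take_Cons split: option.splits nat.splits)

lemma take_preferences: "take r (preferences C bs) = preferences C (take r bs)"
  by (induction bs arbitrary: C r) (auto simp: take_Cons split: nat.splits)

lemma block_starts_distinct:
  "distinct as \<Longrightarrow> set as \<inter> dom M = {} \<Longrightarrow> block_starts M as = as"
proof (induction as arbitrary: M)
  case (Cons a as)
  then have "M a = None" by auto
  with Cons show ?case by auto
qed simp

lemma preferences_distinct:
  "distinct bs \<Longrightarrow> \<forall>b\<in>set bs. C b = 0 \<Longrightarrow> preferences C bs = bs"
proof (induction bs arbitrary: C)
  case (Cons b bs)
  then have "\<forall>x\<in>set bs. (C(b := C b + 1)) x = 0" by auto
  with Cons show ?case by simp
qed simp

section \<open>The two maps undo each other\<close>

text \<open>Induction over the cars, keeping both states in step. The second conjunct records the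
  final occupancy: with \<open>m\<close> cars, counting spots forces the blocks to fill
  \<open>{1..m}\<close>.\<close>

lemma preferences_block_starts:
  assumes "tiled M C" "all_park m (dom M) as" "dom M \<subseteq> {1..m}" "set as \<subseteq> {1..m}"
  shows "preferences C (block_starts M as) = as \<and>
    (\<exists>M'. tiled M' (\<lambda>x. C x + count_list (block_starts M as) x) \<and> dom M' \<subseteq> {1..m} \<and>
       card (dom M') = card (dom M) + length as)"
  using assms
proof (induction as arbitrary: M C)
  case Nil
  then show ?case by auto
next
  case (Cons a as)
  have fin: "finite (dom M)"
    using Cons.prems(3) finite_subset by blast
  \<comment> \<open>Both ways of parking take one form: the car joins block \<open>b\<close>,
    possibly still empty, and takes its next spot \<open>b + C b\<close>. For an empty block the
    truncated subtraction gives \<open>a = b\<close>.\<close>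
  obtain b where b: "block_starts M (a # as) = b # block_starts (M(b + C b \<mapsto> b)) as"
    "a = b + (C b - 1)" "M (b + C b) = None" "b + C b \<in> {1..m}"
    "all_park m (insert (b + C b) (dom M)) as"
  proof (cases "M a")
    case None
    then have "C a = 0" using tiledD[OF Cons.prems(1), of a a] by (cases "C a") auto
    with None Cons.prems show thesis
      by (intro that[of a]) (auto simp: unit_spot_def domIff)
  next
    case (Some b)
    then have ab: "b \<le> a" "a < b + C b"
      using tiledD[OF Cons.prems(1), of a b] by auto
    have free: "a + 1 \<le> m" "M (a + 1) = None" "all_park m (insert (a + 1) (dom M)) as"
      using Some Cons.prems(2) by (auto simp: unit_spot_def domIff split: if_splits)
    \<comment> \<open>Spot \<open>a\<close> lies in block \<open>b\<close> and \<open>a + 1\<close>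
      is free, so \<open>a\<close> is the last spot of that block.\<close>
    then have "a + 1 = b + C b"
      using tiledD[OF Cons.prems(1), of "a + 1" b] ab by auto
    with Some free ab show thesis
      by (intro that[of b]) auto
  qed
  let ?M = "M(b + C b \<mapsto> b)" and ?C = "C(b := C b + 1)"
  have IH: "preferences ?C (block_starts ?M as) = as \<and>
    (\<exists>M'. tiled M' (\<lambda>x. ?C x + count_list (block_starts ?M as) x) \<and> dom M' \<subseteq> {1..m} \<and>
       card (dom M') = card (dom ?M) + length as)"
  proof (rule Cons.IH)
    show "tiled ?M ?C" by (rule tiled_update[OF Cons.prems(1) b(3)])
    show "all_park m (dom ?M) as" using b(5) by simp
    show "dom ?M \<subseteq> {1..m}" using b(4) Cons.prems(3) by simp
    show "set as \<subseteq> {1..m}" using Cons.prems(4) by simp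
  qed
  have count: "(\<lambda>x. ?C x + count_list (block_starts ?M as) x) =
      (\<lambda>x. C x + count_list (block_starts M (a # as)) x)"
    using b(1) by auto
  have "card (dom ?M) = card (dom M) + 1"
    using b(3) fin by (simp add: domIff)
  with IH b(1,2) show ?case unfolding count by auto
qed

text \<open>The sum \<open>C x + count_list bs x\<close> is the final size of block \<open>x\<close>
  and does not change along the recursion. So the hypotheses on the final blocks pass unchanged to
  the tail.\<close>

lemma block_starts_preferences:
  assumes "tiled M C"
    and "\<And>x y. C x + count_list bs x > 0 \<Longrightarrow> C y + count_list bs y > 0 \<Longrightarrow> x < y \<Longrightarrow>
           x + (C x + count_list bs x) \<le> y"
    and "\<And>x. C x + count_list bs x > 0 \<Longrightarrow> 1 \<le> x \<and> x + (C x + count_list bs x) \<le> m + 1"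
  shows "block_starts M (preferences C bs) = bs \<and> all_park m (dom M) (preferences C bs) \<and>
    set (preferences C bs) \<subseteq> {1..m}"
  using assms
proof (induction bs arbitrary: M C)
  case Nil
  then show ?case by auto
next
  case (Cons b bs)
  let ?M = "M(b + C b \<mapsto> b)" and ?C = "C(b := C b + 1)"
  have count: "?C x + count_list bs x = C x + count_list (b # bs) x" for x
    by auto
  have range: "1 \<le> b" "b + C b \<le> m"
    using Cons.prems(3)[of b] by auto
  have free: "M (b + C b) = None"
  \<comment> \<open>The final block of \<open>b\<close> contains \<open>b + C b\<close>, as the
    current \<open>b\<close> is still to be counted. If another block held this spot, two final
    blocks would overlap.\<close>
  proof (rule ccontr)
    assume "M (b + C b) \<noteq> None"
    then obtain z where z: "z \<le> b + C b" "b + C b < z + C z"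
      using tiledD[OF Cons.prems(1)] by blast
    then have "z \<noteq> b" by auto
    then consider "z < b" | "b < z" by linarith
    then show False
    proof cases
      case 1
      then show False using Cons.prems(2)[of z b] z by auto
    next
      case 2
      then show False using Cons.prems(2)[of b z] z by auto
    qed
  qed
  have IH: "block_starts ?M (preferences ?C bs) = bs \<and> all_park m (dom ?M) (preferences ?C bs) \<and>
    set (preferences ?C bs) \<subseteq> {1..m}"
  proof (rule Cons.IH[OF tiled_update[OF Cons.prems(1) free]], unfold count)
    show "x + (C x + count_list (b # bs) x) \<le> y"
      if "C x + count_list (b # bs) x > 0" "C y + count_list (b # bs) y > 0" "x < y" for x y
      using that by (rule Cons.prems(2))
    show "1 \<le> x \<and> x + (C x + count_list (b # bs) x) \<le> m + 1"
      if "C x + count_list (b # bs) x > 0" for x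
      using that by (rule Cons.prems(3))
  qed
  show ?case
  proof (cases "C b = 0")
    case True
    with free IH range show ?thesis
      by (auto simp: unit_spot_def domIff)
  next
    case False
    \<comment> \<open>The preference is the last occupied spot of block \<open>b\<close>, so the car
      is bumped to the free spot after it.\<close>
    then have "M (b + (C b - 1)) = Some b" "Suc (b + (C b - 1)) = b + C b"
      using tiledD[OF Cons.prems(1)] by auto
    with free IH range show ?thesis
      by (auto simp: unit_spot_def domIff)
  qed
qed

section \<open>Fubini rankings as tilings\<close>

text \<open>The blocks leave no gap in \<open>{1..m}\<close>, so each next block starts right where
  the previous one ends.\<close>

lemma fubini_ranking_if_tiled:
  assumes "tiled M (count_list \<beta>)" "dom M = {1..m}" "length \<beta> = m" "m \<ge> 1"
  shows "fubini_ranking m \<beta>"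
proof -
  note M = tiledD[OF assms(1)]
  have in_set: "b \<in> set \<beta> \<longleftrightarrow> M b = Some b" for b
    using M[of b b] by (simp add: count_list_pos_iff)
  have range: "set \<beta> \<subseteq> {1..m}"
  proof
    fix b assume "b \<in> set \<beta>"
    then have "b \<in> dom M" using in_set[of b] by auto
    then show "b \<in> {1..m}" using assms(2) by simp
  qed
  have start: "\<exists>b\<in>set \<beta>. M s = Some b" if "s \<in> {1..m}" for s
  proof -
    have "s \<in> dom M" using that assms(2) by simp
    then obtain b where b: "M s = Some b" by blast
    then have "M b = Some b" using M[of s b] M[of b b] by auto
    then have "b \<in> set \<beta>" using in_set[of b] by simp
    with b show ?thesis by auto
  qed
  obtain b where "b \<in> set \<beta>" "M 1 = Some b"
    using start[of 1] assms(4) by auto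
  moreover from this have "b = 1"
    using M[of 1 b] range by (metis One_nat_def atLeastAtMost_iff le_antisym subsetD)
  ultimately have "Min (set \<beta>) = 1"
    using range by (intro Min_eqI) auto
  moreover have "y = x + count_list \<beta> x" if "count_list \<beta> x > 0" and y: "next_value \<beta> x y" for x y
  proof -
    have "y \<in> set \<beta>" "x < y" using y by (auto simp: next_value_def)
    then have lower: "x + count_list \<beta> x \<le> y"
      using in_set[of y] M[of y x] by (cases "y < x + count_list \<beta> x") auto
    have "x + count_list \<beta> x \<in> {1..m}"
      using lower \<open>y \<in> set \<beta>\<close> range that(1) by auto
    \<comment> \<open>\<open>z\<close> starts the block covering the first spot after block
      \<open>x\<close>. If \<open>z \<le> x\<close>, that block would also cover \<open>x\<close>,
      forcing \<open>z = x\<close>, whose block has already ended.\<close>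
    then obtain z where z: "z \<in> set \<beta>" "M (x + count_list \<beta> x) = Some z"
      using start by blast
    have "x < z"
    proof (rule ccontr)
      assume "\<not> x < z"
      then have "M x = Some z" using z(2) M[of "x + count_list \<beta> x" z] M[of x z] by auto
      moreover have "M x = Some x" using that(1) M[of x x] by simp
      ultimately show False using z(2) M[of "x + count_list \<beta> x" z] by auto
    qed
    then have "y \<le> z" using y z(1) by (auto simp: next_value_def)
    also have "z \<le> x + count_list \<beta> x" using z(2) M[of "x + count_list \<beta> x" z] by simp
    finally show ?thesis using lower by simp
  qed
  ultimately show ?thesis
    using range assms(3) by (auto simp: fubini_ranking_def tuples_def)
qed

text \<open>The least value above \<open>x\<close> is \<open>x + count_list \<beta> x\<close>, and
  \<open>y\<close> is at least that value.\<close>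

lemma fubini_ranking_disjoint:
  assumes "fubini_ranking m \<beta>" "x \<in> set \<beta>" "y \<in> set \<beta>" "x < y"
  shows "x + count_list \<beta> x \<le> y"
proof -
  let ?z = "Min {z \<in> set \<beta>. x < z}"
  have "?z \<in> {z \<in> set \<beta>. x < z}"
    using assms by (intro Min_in) auto
  then have "next_value \<beta> x ?z"
    by (auto simp: next_value_def)
  moreover have "count_list \<beta> x > 0"
    using assms(2) by (simp add: count_list_pos_iff)
  ultimately have "?z = x + count_list \<beta> x"
    using assms(1) by (auto simp: fubini_ranking_def)
  moreover have "?z \<le> y" using assms by (intro Min_le) auto
  ultimately show ?thesis by simp
qed

text \<open>The union of the blocks is an initial segment of the positive integers with at most \<open>m\<close>
  elements.\<close>

lemma fubini_ranking_bounded: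
  assumes "fubini_ranking m \<beta>" "x \<in> set \<beta>"
  shows "x + count_list \<beta> x \<le> m + 1"
proof -
  let ?T = "\<Union>b\<in>set \<beta>. {b..<b + count_list \<beta> b}"
  have len: "length \<beta> = m" and range: "set \<beta> \<subseteq> {1..m}" and min: "Min (set \<beta>) = 1"
    using assms(1) by (auto simp: fubini_ranking_def tuples_def)
  have pos: "count_list \<beta> b > 0" if "b \<in> set \<beta>" for b
    using that by (simp add: count_list_pos_iff)
  have "set \<beta> \<noteq> {}" using assms(2) by auto
  then have one: "1 \<in> set \<beta>"
    using Min_in[of "set \<beta>"] by (simp add: min)
  have down: "s \<in> ?T" if s: "Suc s \<in> ?T" "s \<ge> 1" for s
  proof -
    obtain b where b: "b \<in> set \<beta>" "b \<le> Suc s" "Suc s < b + count_list \<beta> b"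
      using s(1) by auto
    show ?thesis
    proof (cases "b = Suc s")
      case False
      with b show ?thesis by (auto intro!: bexI[of _ b])
    next
      case True
      \<comment> \<open>When \<open>Suc s\<close> starts a block, \<open>s\<close> is the last spot
        of the block of the preceding value \<open>?p\<close>, which exists because \<open>1\<close>
        occurs in \<open>\<beta>\<close>.\<close>
      let ?p = "Max {z \<in> set \<beta>. z < b}"
      have "?p \<in> {z \<in> set \<beta>. z < b}"
        using one True s(2) by (intro Max_in) auto
      then have p: "?p \<in> set \<beta>" "?p < b" by auto
      have "b \<le> z" if "z \<in> set \<beta>" "?p < z" for z
      proof (rule ccontr)
        assume "\<not> b \<le> z"
        then have "z \<le> ?p" using that(1) by (intro Max_ge) auto
        with that(2) show False by linarith
      qed
      with p b(1) have "next_value \<beta> ?p b"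
        by (auto simp: next_value_def)
      then have "b = ?p + count_list \<beta> ?p"
        using assms(1) pos[OF p(1)] by (auto simp: fubini_ranking_def)
      with True p show ?thesis by (intro UN_I[of ?p]) auto
    qed
  qed
  let ?s = "x + count_list \<beta> x - 1"
  have "?s \<in> ?T"
    using assms(2) pos[OF assms(2)] by (intro UN_I[of x]) auto
  then have "t \<in> ?T" if "t \<in> {1..?s}" for t
  proof -
    have "t \<le> ?s" "1 \<le> t" using that by auto
    then show ?thesis
    proof (induction rule: inc_induct)
      case base
      show ?case using \<open>?s \<in> ?T\<close> .
    next
      case (step n)
      then show ?case using down[of n] by simp
    qed
  qed
  \<comment> \<open>The block sizes add up to the length of \<open>\<beta>\<close>, which bounds the
    end \<open>?s\<close> of block \<open>x\<close> by \<open>m\<close>.\<close>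
  then have "card {1..?s} \<le> card ?T"
    by (intro card_mono) auto
  also have "\<dots> \<le> (\<Sum>b\<in>set \<beta>. card {b..<b + count_list \<beta> b})"
    by (rule card_UN_le) simp
  also have "\<dots> = m"
    using sum_count_set[of \<beta> "set \<beta>"] len by simp
  finally show ?thesis by simp
qed

section \<open>The bijection\<close>

lemma UPF_to_FR:
  assumes "\<alpha> \<in> UPF m r" "m \<ge> r" "r \<ge> 1"
  shows "block_starts Map.empty \<alpha> \<in> FR m r"
    and "preferences (\<lambda>_. 0) (block_starts Map.empty \<alpha>) = \<alpha>"
proof -
  have \<alpha>: "length \<alpha> = m" "set \<alpha> \<subseteq> {1..m}" "all_park m {} \<alpha>" "card (set (take r \<alpha>)) = r"
    using assms(1) by (auto simp: UPF_def unit_interval_pf_def tuples_def)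
  let ?\<beta> = "block_starts Map.empty \<alpha>"
  have "preferences (\<lambda>_. 0) ?\<beta> = \<alpha> \<and> (\<exists>M'. tiled M' (\<lambda>x. 0 + count_list ?\<beta> x) \<and>
      dom M' \<subseteq> {1..m} \<and> card (dom M') = card (dom (Map.empty :: nat \<Rightarrow> nat option)) + length \<alpha>)"
    using \<alpha> by (intro preferences_block_starts tiled_empty) auto
  then obtain M where inverse: "preferences (\<lambda>_. 0) ?\<beta> = \<alpha>"
    and M: "tiled M (count_list ?\<beta>)" "dom M \<subseteq> {1..m}" "card (dom M) = m"
    using \<alpha>(1) by auto
  show "preferences (\<lambda>_. 0) ?\<beta> = \<alpha>" by (rule inverse)
  \<comment> \<open>The \<open>m\<close> cars occupy \<open>m\<close> different spots, hence all of
    them.\<close>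
  have "dom M = {1..m}"
    using M by (intro card_subset_eq) auto
  then have "fubini_ranking m ?\<beta>"
    using M \<alpha>(1) assms by (intro fubini_ranking_if_tiled) auto
  moreover have "distinct (take r \<alpha>)"
    using \<alpha> assms(2) by (intro card_distinct) auto
  then have "take r ?\<beta> = take r \<alpha>"
    by (simp add: take_block_starts block_starts_distinct)
  ultimately show "?\<beta> \<in> FR m r"
    using \<alpha>(4) by (simp add: FR_def)
qed

text \<open>Starting from zero counts, the final blocks are those of \<open>\<beta>\<close>, which
  are disjoint and stay within \<open>{1..m}\<close>.\<close>

lemma FR_to_UPF:
  assumes "\<beta> \<in> FR m r" "m \<ge> r"
  shows "preferences (\<lambda>_. 0) \<beta> \<in> UPF m r"
    and "block_starts Map.empty (preferences (\<lambda>_. 0) \<beta>) = \<beta>"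
proof -
  have fub: "fubini_ranking m \<beta>" and card: "card (set (take r \<beta>)) = r"
    using assms(1) by (auto simp: FR_def)
  have \<beta>: "length \<beta> = m" "set \<beta> \<subseteq> {1..m}"
    using fub by (auto simp: fubini_ranking_def tuples_def)
  let ?\<alpha> = "preferences (\<lambda>_. 0) \<beta>"
  have in_set: "b \<in> set \<beta>" if "0 + count_list \<beta> b > 0" for b
    using that by (simp add: count_list_pos_iff)
  have main: "block_starts Map.empty ?\<alpha> = \<beta> \<and>
      all_park m (dom (Map.empty :: nat \<Rightarrow> nat option)) ?\<alpha> \<and> set ?\<alpha> \<subseteq> {1..m}"
  proof (rule block_starts_preferences[OF tiled_empty])
    fix x y assume "0 + count_list \<beta> x > 0" "0 + count_list \<beta> y > 0" "x < y"
    then show "x + (0 + count_list \<beta> x) \<le> y"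
      using fubini_ranking_disjoint[OF fub] in_set by simp
  next
    fix x assume "0 + count_list \<beta> x > 0"
    then have "x \<in> set \<beta>" by (rule in_set)
    then show "1 \<le> x \<and> x + (0 + count_list \<beta> x) \<le> m + 1"
      using fubini_ranking_bounded[OF fub] \<beta>(2) by auto
  qed
  then show "block_starts Map.empty ?\<alpha> = \<beta>" by blast
  have "distinct (take r \<beta>)"
    using \<beta> card assms(2) by (intro card_distinct) auto
  then have "take r ?\<alpha> = take r \<beta>"
    by (simp add: take_preferences preferences_distinct)
  with main \<beta>(1) card show "?\<alpha> \<in> UPF m r"
    by (simp add: UPF_def unit_interval_pf_def tuples_def)
qed

theorem theorem3p5:
  fixes n r m :: nat
  assumes "r \<ge> 1" and "m = n + r"
  shows "\<exists>f. bij_betw f (UPF m r) (FR m r)"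
proof
  show "bij_betw (block_starts Map.empty) (UPF m r) (FR m r)"
    using assms UPF_to_FR FR_to_UPF
    by (intro bij_betw_byWitness[where f' = "preferences (\<lambda>_. 0)"]) auto
qed

end
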